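(* Let $k > 0$ be an integer. For every $\mathcal{EMLC}$ formula $\psi$ of depth $k$ there is an iterated decision tree $\{L_i\}_{i\in[k]}$ with $k$ layers such that $\chi_0^{k-1}$ (the formula of the leaf set with index $0$ of the last layer $L_{k-1}$) is equivalent to $\psi$. Conversely, for every iterated decision tree $\{L_i\}_{i\in[k]}$ with $k$ layers and every formula $\chi_j^{k-1}$ associated with a leaf set of its last layer $L_{k-1}$, there is an $\mathcal{EMLC}$ formula $\psi$ of depth $k$ that is equivalent to $\chi_j^{k-1}$.
   Context: Notation: $[n]=\{0,\dots,n-1\}$. Graphs: graphs $G$ are finite, simple and undirected, with node set $V$; $N(v)$ is the set of neighbors of $v$. Each graph carries $m$ unary predicates $U_0,\dots,U_{m-1}$ on its nodes ($m$ is fixed). Modal parameters: a modal parameter $S$ is one of the eight symbols $0, 1, I, A, 1-I, 1-A, I+A, 1-I-A$. For a node $v$ of $G$, its interpretation $\varepsilon_S(v)\subseteq V$ is: $\varepsilon_0(v)=\emptyset$, $\varepsilon_1(v)=V$, $\varepsilon_I(v)=\{v\}$, $\varepsilon_A(v)=N(v)$, $\varepsilon_{1-I}(v)=V\setminus\{v\}$, $\varepsilon_{1-A}(v)=V\setminus N(v)$, $\varepsilon_{I+A}(v)=\{v\}\cup N(v)$, $\varepsilon_{1-I-A}(v)=V\setminus(\{v\}\cup N(v))$. $\mathcal{EMLC}$ formulas are given by the grammar $$\varphi ::= U_j \mid \top \mid \varphi\wedge\varphi \mid \varphi\vee\varphi \mid \neg\varphi \mid S\varphi > n,$$ where $j\in[m]$,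 $S$ ranges over modal parameters and $n$ over $\mathbb N$ (including $0$). Formulas are evaluated at pairs $(G,v)$ with $v$ a node of $G$: $(G,v)\models U_j$ iff $U_j(v)$ holds in $G$; $\top$ is always true; Boolean connectives are as usual; and $(G,v)\models S\varphi>n$ iff there are more than $n$ nodes $w\in\varepsilon_S(v)$ with $(G,w)\models\varphi$. The depth of a formula is the maximal number of nested modal parameters. Two formulas are equivalent (written $\Leftrightarrow$) if they hold at the same pairs $(G,v)$. Decision trees: a decision tree is a finite rooted tree in which each node has at most two children, each inner (non-leaf) node $u$ is labeled with a formula $\varphi_u$ (its splitting decision), and the edges from an inner node to its children are labeled by distinct values among True and False. For a leaf $v$, $\chi_v$ is the conjunction, over all inner nodes $u$ on the path from the root to $v$, of $\varphi_u$ if the path leaves $u$ along its True edge and of $\neg\varphi_u$ if it leaves along its False edge (the empty conjunction is $\top$). For a set $M$ of leaves (a leaf set), $\chi_M:=\bigvee\{\chi_v : v\in M\}$ (the empty disjunction is false). Iterated decision trees: an iterated decision tree layer $L$ consists of a decision tree $T$ all of whose splitting decisions have the form $S\varphi>n$ with $S$ a modal parameter, $\varphi$ an $\mathcal{EMLC}$ formula and $n\in\mathbb N$, together with a finite indexed family $\{M_j\}$ of leaf sets of $T$. A sequence of $k$ layers $\{L_i\}_{i\in[k]}$ is an iterated decision tree (with $k$ layers) if for every $i\in[k]$ and every splitting decision $S\varphi>n$ occurring in $L_i$, either $\varphi$ has depth $0$ or $\varphi\Leftrightarrow\chi_M$ for some leaf set $M$ in the family of some layer $L_{l}$ with $l<i$.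 $M_j^i$ denotes the $j$-th leaf set of $L_i$ and $\chi_j^i:=\chi_{M_j^i}$. *)

theory Defs
  imports Main
begin

record 'v graph =
  nodes :: "'v set"
  edges :: "'v set set"
  preds :: "'v set list"

definition graph :: "nat \<Rightarrow> 'v graph \<Rightarrow> bool" where
  "graph m G \<longleftrightarrow>
     finite (nodes G) \<and>
     (\<forall>e\<in>edges G. \<exists>u\<in>nodes G. \<exists>v\<in>nodes G. u \<noteq> v \<and> e = {u, v}) \<and>
     length (preds G) = m \<and> (\<forall>X\<in>set (preds G). X \<subseteq> nodes G)"

definition nbrs :: "'v graph \<Rightarrow> 'v \<Rightarrow> 'v set" where
  "nbrs G v = {w. {v, w} \<in> edges G}"

text \<open>\<open>m\<close> in a constructor name reads "minus", \<open>p\<close> reads "plus".\<close>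

datatype modal_param = P_0 | P_1 | P_I | P_A | P_1mI | P_1mA | P_IpA | P_1mImA

fun eps :: "'v graph \<Rightarrow> modal_param \<Rightarrow> 'v \<Rightarrow> 'v set" where
  "eps G P_0 v = {}"
| "eps G P_1 v = nodes G"
| "eps G P_I v = {v}"
| "eps G P_A v = nbrs G v"
| "eps G P_1mI v = nodes G - {v}"
| "eps G P_1mA v = nodes G - nbrs G v"
| "eps G P_IpA v = {v} \<union> nbrs G v"
| "eps G P_1mImA v = nodes G - ({v} \<union> nbrs G v)"

text \<open>\<open>More S \<phi> n\<close> is the formula \<open>S \<phi> > n\<close>.\<close>

datatype form =
    Pred nat
  | Top
  | Conj form form
  | Disj form form
  | Neg form
  | More modal_param form nat

primrec pred_indices :: "form \<Rightarrow> nat set" where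
  "pred_indices (Pred j) = {j}"
| "pred_indices Top = {}"
| "pred_indices (Conj \<phi> \<psi>) = pred_indices \<phi> \<union> pred_indices \<psi>"
| "pred_indices (Disj \<phi> \<psi>) = pred_indices \<phi> \<union> pred_indices \<psi>"
| "pred_indices (Neg \<phi>) = pred_indices \<phi>"
| "pred_indices (More S \<phi> n) = pred_indices \<phi>"

definition EMLC :: "nat \<Rightarrow> form set" where
  "EMLC m = {\<phi>. pred_indices \<phi> \<subseteq> {..<m}}"

primrec depth :: "form \<Rightarrow> nat" where
  "depth (Pred j) = 0"
| "depth Top = 0"
| "depth (Conj \<phi> \<psi>) = max (depth \<phi>) (depth \<psi>)"
| "depth (Disj \<phi> \<psi>) = max (depth \<phi>) (depth \<psi>)"
| "depth (Neg \<phi>) = depth \<phi>"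
| "depth (More S \<phi> n) = Suc (depth \<phi>)"

primrec sat :: "'v graph \<Rightarrow> 'v \<Rightarrow> form \<Rightarrow> bool" where
  "sat G v (Pred j) \<longleftrightarrow> v \<in> preds G ! j"
| "sat G v Top \<longleftrightarrow> True"
| "sat G v (Conj \<phi> \<psi>) \<longleftrightarrow> sat G v \<phi> \<and> sat G v \<psi>"
| "sat G v (Disj \<phi> \<psi>) \<longleftrightarrow> sat G v \<phi> \<or> sat G v \<psi>"
| "sat G v (Neg \<phi>) \<longleftrightarrow> \<not> sat G v \<phi>"
| "sat G v (More S \<phi> n) \<longleftrightarrow> card {w \<in> eps G S v. sat G w \<phi>} > n"

text \<open>
  A definition cannot quantify over node types, so equivalence refers to graphs whose nodes are
  natural numbers. Every finite graph is isomorphic to such a graph, and \<open>equivalentD\<close> below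
  shows that equivalent formulas agree on the graphs over every node type.
\<close>

definition equivalent :: "nat \<Rightarrow> form \<Rightarrow> form \<Rightarrow> bool" where
  "equivalent m \<phi> \<psi> \<longleftrightarrow>
     (\<forall>(G :: nat graph) v. graph m G \<longrightarrow> v \<in> nodes G \<longrightarrow> (sat G v \<phi> \<longleftrightarrow> sat G v \<psi>))"

definition map_graph :: "('v \<Rightarrow> 'w) \<Rightarrow> 'v graph \<Rightarrow> 'w graph" where
  "map_graph f G =
     \<lparr>nodes = f ` nodes G, edges = (`) f ` edges G, preds = map ((`) f) (preds G)\<rparr>"

lemma edgeE:
  assumes "graph m G" and "e \<in> edges G"
  obtains u v where "u \<in> nodes G" "v \<in> nodes G" "u \<noteq> v" "e = {u, v}"
proof -
  have "\<exists>u\<in>nodes G. \<exists>v\<in>nodes G. u \<noteq> v \<and> e = {u, v}"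
    using assms unfolding graph_def by simp
  then show thesis
    using that by (elim bexE conjE)
qed

lemma edge_nodes: "graph m G \<Longrightarrow> {v, w} \<in> edges G \<Longrightarrow> v \<in> nodes G \<and> w \<in> nodes G"
  by (erule (1) edgeE) (auto simp: doubleton_eq_iff)

lemma nbrs_subset: "graph m G \<Longrightarrow> nbrs G v \<subseteq> nodes G"
  unfolding nbrs_def by (auto dest: edge_nodes)

lemma eps_subset: "graph m G \<Longrightarrow> v \<in> nodes G \<Longrightarrow> eps G S v \<subseteq> nodes G"
  using nbrs_subset[of m G v] by (cases S) auto

lemma graph_map_graph:
  assumes "graph m G" and "inj_on f (nodes G)"
  shows "graph m (map_graph f G)"
proof -
  have "\<exists>u\<in>f ` nodes G. \<exists>v\<in>f ` nodes G. u \<noteq> v \<and> f ` e = {u, v}" if "e \<in> edges G" for e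
  proof -
    obtain u v where uv: "u \<in> nodes G" "v \<in> nodes G" "u \<noteq> v" "e = {u, v}"
      by (rule edgeE[OF assms(1) \<open>e \<in> edges G\<close>])
    then have "f u \<noteq> f v"
      using assms(2) by (meson inj_onD)
    then show ?thesis
      using uv by auto
  qed
  then show ?thesis
    using assms(1) unfolding graph_def map_graph_def by (simp add: image_mono)
qed

lemma nbrs_map_graph:
  assumes "graph m G" and "inj_on f (nodes G)" and "v \<in> nodes G"
  shows "nbrs (map_graph f G) (f v) = f ` nbrs G v"
proof (intro equalityI subsetI)
  fix y assume "y \<in> nbrs (map_graph f G) (f v)"
  then obtain e where e: "e \<in> edges G" "{f v, y} = f ` e"
    by (auto simp: nbrs_def map_graph_def)
  obtain a b where ab: "a \<in> nodes G" "b \<in> nodes G" "a \<noteq> b" "e = {a, b}"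
    by (rule edgeE[OF assms(1) e(1)])
  then have "{f v, y} = {f a, f b}"
    using e(2) by simp
  then consider "f v = f a" "y = f b" | "f v = f b" "y = f a"
    by (auto simp: doubleton_eq_iff)
  then show "y \<in> f ` nbrs G v"
  proof cases
    case 1
    then have "v = a" using assms(2,3) ab(1) by (meson inj_onD)
    then show ?thesis using 1 e(1) ab(4) by (auto simp: nbrs_def)
  next
    case 2
    then have "v = b" using assms(2,3) ab(2) by (meson inj_onD)
    then show ?thesis using 2 e(1) ab(4) by (auto simp: nbrs_def insert_commute)
  qed
next
  fix y assume "y \<in> f ` nbrs G v"
  then obtain w where "y = f w" "{v, w} \<in> edges G"
    by (auto simp: nbrs_def)
  then show "y \<in> nbrs (map_graph f G) (f v)"
    by (auto simp: nbrs_def map_graph_def intro: rev_image_eqI)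
qed

lemma eps_map_graph:
  assumes "graph m G" and "inj_on f (nodes G)" and "v \<in> nodes G"
  shows "eps (map_graph f G) S (f v) = f ` eps G S v"
proof -
  have diff: "f ` (nodes G - X) = f ` nodes G - f ` X" if "X \<subseteq> nodes G" for X
    using assms(2) that by (simp add: inj_on_image_set_diff)
  have "nodes (map_graph f G) = f ` nodes G"
    by (simp add: map_graph_def)
  then show ?thesis
    using nbrs_map_graph[OF assms] nbrs_subset[OF assms(1), of v] assms(3)
    by (cases S) (simp_all add: diff)
qed

lemma sat_map_graph:
  assumes "graph m G" and "inj_on f (nodes G)" and "v \<in> nodes G" and "\<phi> \<in> EMLC m"
  shows "sat (map_graph f G) (f v) \<phi> \<longleftrightarrow> sat G v \<phi>"
  using assms(3,4)
proof (induction \<phi> arbitrary: v)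
  case (Pred j)
  then have j: "j < length (preds G)" "preds G ! j \<subseteq> nodes G"
    using assms(1) by (auto simp: EMLC_def graph_def)
  then show ?case
    using inj_on_image_mem_iff[OF assms(2) Pred.prems(1) j(2)] by (simp add: map_graph_def)
next
  case (More S \<phi> n)
  have sub: "eps G S v \<subseteq> nodes G"
    using eps_subset[OF assms(1) More.prems(1)] .
  have "\<phi> \<in> EMLC m"
    using More.prems(2) by (simp add: EMLC_def)
  then have "{w \<in> eps (map_graph f G) S (f v). sat (map_graph f G) w \<phi>} =
      f ` {w \<in> eps G S v. sat G w \<phi>}"
    using More.IH sub unfolding eps_map_graph[OF assms(1,2) More.prems(1)] by blast
  moreover have "inj_on f {w \<in> eps G S v. sat G w \<phi>}"
    using assms(2) by (rule inj_on_subset) (use sub in blast)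
  ultimately show ?case
    by (simp add: card_image)
qed (auto simp: EMLC_def)

lemma equivalentD:
  fixes G :: "'v graph"
  assumes "equivalent m \<phi> \<psi>" and "\<phi> \<in> EMLC m" and "\<psi> \<in> EMLC m"
    and "graph m G" and "v \<in> nodes G"
  shows "sat G v \<phi> \<longleftrightarrow> sat G v \<psi>"
proof -
  have "finite (nodes G)"
    using assms(4) by (simp add: graph_def)
  then obtain f :: "'v \<Rightarrow> nat" where f: "inj_on f (nodes G)"
    using finite_imp_inj_to_nat_seg by blast
  have "f v \<in> nodes (map_graph f G)"
    using assms(5) by (simp add: map_graph_def)
  then have "sat (map_graph f G) (f v) \<phi> \<longleftrightarrow> sat (map_graph f G) (f v) \<psi>"
    using assms(1) graph_map_graph[OF assms(4) f] unfolding equivalent_def by blast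
  then show ?thesis
    using sat_map_graph[OF assms(4) f assms(5)] assms(2,3) by simp
qed

text \<open>
  The constructors of inner nodes reflect which of the outgoing edges exist. In \<open>Both\<close> the first
  subtree hangs at the True edge. A leaf is identified with the list of edge labels on the path
  from the root to it.
\<close>

datatype (decisions: 'f) dtree =
    Leaf
  | OnlyTrue 'f "'f dtree"
  | OnlyFalse 'f "'f dtree"
  | Both 'f "'f dtree" "'f dtree"

primrec leaves :: "'f dtree \<Rightarrow> bool list list" where
  "leaves Leaf = [[]]"
| "leaves (OnlyTrue \<phi> t) = map (Cons True) (leaves t)"
| "leaves (OnlyFalse \<phi> t) = map (Cons False) (leaves t)"
| "leaves (Both \<phi> t t') = map (Cons True) (leaves t) @ map (Cons False) (leaves t')"

text \<open>The following function is meaningful only if the path leads to a leaf of the tree.\<close>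

primrec path_literals :: "form dtree \<Rightarrow> bool list \<Rightarrow> form list" where
  "path_literals Leaf p = []"
| "path_literals (OnlyTrue \<phi> t) p = \<phi> # path_literals t (tl p)"
| "path_literals (OnlyFalse \<phi> t) p = Neg \<phi> # path_literals t (tl p)"
| "path_literals (Both \<phi> t t') p =
     (if hd p then \<phi> # path_literals t (tl p) else Neg \<phi> # path_literals t' (tl p))"

definition chi_leaf :: "form dtree \<Rightarrow> bool list \<Rightarrow> form" where
  "chi_leaf T p = foldr Conj (path_literals T p) Top"

text \<open>The disjunction over a leaf set is taken in the left-to-right order of the leaves.\<close>

definition chi_set :: "form dtree \<Rightarrow> bool list set \<Rightarrow> form" where
  "chi_set T M = foldr Disj (map (chi_leaf T) (filter (\<lambda>p. p \<in> M) (leaves T))) (Neg Top)"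

record layer =
  tree :: "form dtree"
  leaf_sets :: "bool list set list"

definition idt_layer :: "nat \<Rightarrow> layer \<Rightarrow> bool" where
  "idt_layer m L \<longleftrightarrow>
     (\<forall>\<delta>\<in>decisions (tree L). \<exists>S \<phi> n. \<delta> = More S \<phi> n \<and> \<phi> \<in> EMLC m) \<and>
     (\<forall>M\<in>set (leaf_sets L). M \<subseteq> set (leaves (tree L)))"

definition iterated_decision_tree :: "nat \<Rightarrow> nat \<Rightarrow> layer list \<Rightarrow> bool" where
  "iterated_decision_tree m k Ls \<longleftrightarrow>
     length Ls = k \<and> (\<forall>L\<in>set Ls. idt_layer m L) \<and>
     (\<forall>i<k. \<forall>S \<phi> n. More S \<phi> n \<in> decisions (tree (Ls ! i)) \<longrightarrow>
        depth \<phi> = 0 \<or>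
        (\<exists>l<i. \<exists>M\<in>set (leaf_sets (Ls ! l)). equivalent m \<phi> (chi_set (tree (Ls ! l)) M)))"

definition chi :: "layer list \<Rightarrow> nat \<Rightarrow> nat \<Rightarrow> form" where
  "chi Ls i j = chi_set (tree (Ls ! i)) (leaf_sets (Ls ! i) ! j)"

end

theory Submission imports Defs begin

text \<open>
  A formula of depth at most \<open>d + 1\<close> is a Boolean combination of predicates \<open>U\<^sub>j\<close>, which can be
  written as splitting decisions \<open>I U\<^sub>j > 0\<close>, and of formulas \<open>S \<phi> > n\<close> with \<open>\<phi>\<close> of depth at
  most \<open>d\<close>. The complete decision tree over all these splitting decisions has exactly one satisfied
  leaf at every node of a graph, so the formula is equivalent to \<open>\<chi>\<^sub>M\<close>, where \<open>M\<close> collects the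
  leaves at which it can hold. Applied to all subformulas of \<open>\<psi>\<close>, sorted into layers by depth, this
  gives an iterated decision tree for \<open>\<psi>\<close>. Conversely, induction on the layers replaces every
  splitting decision of layer \<open>i\<close> by an equivalent one of depth at most \<open>i + 1\<close>. A formula of depth
  at most \<open>k\<close> is brought to depth exactly \<open>k\<close> by a disjunction with a contradiction of depth \<open>k\<close>.
\<close>

section \<open>Semantics of leaf sets and of equivalence\<close>

lemma sat_foldr_Conj: "sat G v (foldr Conj \<phi>s Top) \<longleftrightarrow> (\<forall>\<phi>\<in>set \<phi>s. sat G v \<phi>)"
  by (induction \<phi>s) auto

lemma sat_foldr_Disj: "sat G v (foldr Disj \<phi>s (Neg Top)) \<longleftrightarrow> (\<exists>\<phi>\<in>set \<phi>s. sat G v \<phi>)"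
  by (induction \<phi>s) auto

lemma sat_chi_set:
  "sat G v (chi_set T M) \<longleftrightarrow> (\<exists>p\<in>set (leaves T) \<inter> M. sat G v (chi_leaf T p))"
  by (auto simp: chi_set_def sat_foldr_Disj)

lemma equivalent_sym: "equivalent m \<phi> \<psi> \<Longrightarrow> equivalent m \<psi> \<phi>"
  by (simp add: equivalent_def)

lemma equivalent_trans: "equivalent m \<phi> \<psi> \<Longrightarrow> equivalent m \<psi> \<chi> \<Longrightarrow> equivalent m \<phi> \<chi>"
  by (simp add: equivalent_def)

text \<open>Equivalence compares formulas at nodes only, which suffices because
  \<open>eps_subset\<close> keeps all counted elements inside the node set.\<close>

lemma equivalent_More:
  assumes "equivalent m \<phi> \<psi>"
  shows "equivalent m (More S \<phi> n) (More S \<psi> n)"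
  unfolding equivalent_def
proof (intro allI impI)
  fix G :: "nat graph" and v
  assume G: "graph m G" and "v \<in> nodes G"
  then have "eps G S v \<subseteq> nodes G"
    by (rule eps_subset)
  then have "{w \<in> eps G S v. sat G w \<phi>} = {w \<in> eps G S v. sat G w \<psi>}"
    using assms G unfolding equivalent_def by blast
  then show "sat G v (More S \<phi> n) \<longleftrightarrow> sat G v (More S \<psi> n)"
    by simp
qed

subsection \<open>From formulas to iterated decision trees\<close>

primrec complete_tree :: "'f list \<Rightarrow> 'f dtree" where
  "complete_tree [] = Leaf"
| "complete_tree (\<delta> # \<delta>s) = Both \<delta> (complete_tree \<delta>s) (complete_tree \<delta>s)"

lemma decisions_complete_tree: "decisions (complete_tree \<delta>s) = set \<delta>s"
  by (induction \<delta>s) auto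

lemma leaves_complete_tree: "set (leaves (complete_tree \<delta>s)) = {p. length p = length \<delta>s}"
proof (induction \<delta>s)
  case (Cons \<delta> \<delta>s)
  have "p \<in> set (leaves (complete_tree (\<delta> # \<delta>s))) \<longleftrightarrow> length p = length (\<delta> # \<delta>s)" for p
    using Cons by (cases p) (auto simp: image_iff)
  then show ?case
    by blast
qed simp

text \<open>A path through the complete tree is a truth assignment to all decisions, and its
  literals assert exactly this assignment.\<close>

lemma sat_chi_leaf_complete_tree:
  "length p = length \<delta>s \<Longrightarrow> sat G v (chi_leaf (complete_tree \<delta>s) p) \<longleftrightarrow> p = map (sat G v) \<delta>s"
proof (induction \<delta>s arbitrary: p)
  case (Cons \<delta> \<delta>s)
  then show ?case
    by (cases p) (auto simp: chi_leaf_def)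
qed (simp add: chi_leaf_def)

lemma sat_chi_set_complete_tree:
  "sat G v (chi_set (complete_tree \<delta>s) M) \<longleftrightarrow> map (sat G v) \<delta>s \<in> M"
  by (auto simp: sat_chi_set leaves_complete_tree sat_chi_leaf_complete_tree)

text \<open>These are the rows of the truth table of \<open>\<phi>\<close> over
  \<open>\<delta>s\<close> that occur with \<open>\<phi>\<close> true. Selecting them semantically
  avoids evaluating the Boolean structure of \<open>\<phi>\<close> on assignments.\<close>

definition possible_leaves :: "nat \<Rightarrow> form list \<Rightarrow> form \<Rightarrow> bool list set" where
  "possible_leaves m \<delta>s \<phi> =
     {map (sat G v) \<delta>s | (G :: nat graph) v. graph m G \<and> v \<in> nodes G \<and> sat G v \<phi>}"

lemma possible_leaves_subset: "possible_leaves m \<delta>s \<phi> \<subseteq> set (leaves (complete_tree \<delta>s))"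
  by (auto simp: possible_leaves_def leaves_complete_tree)

text \<open>By the hypothesis the decisions fix the truth value of \<open>\<phi>\<close> even across
  graphs, so an assignment seen once with \<open>\<phi>\<close> true forces \<open>\<phi>\<close>
  wherever it recurs.\<close>

lemma equivalent_chi_possible_leaves:
  assumes "\<And>(G :: nat graph) v (H :: nat graph) w.
    \<lbrakk>graph m G; v \<in> nodes G; graph m H; w \<in> nodes H; \<forall>\<delta>\<in>set \<delta>s. sat G v \<delta> = sat H w \<delta>\<rbrakk>
      \<Longrightarrow> sat G v \<phi> = sat H w \<phi>"
  shows "equivalent m \<phi> (chi_set (complete_tree \<delta>s) (possible_leaves m \<delta>s \<phi>))"
  unfolding equivalent_def sat_chi_set_complete_tree
proof (intro allI impI iffI)
  fix G :: "nat graph" and v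
  assume G: "graph m G" "v \<in> nodes G"
  show "map (sat G v) \<delta>s \<in> possible_leaves m \<delta>s \<phi>" if "sat G v \<phi>"
    using G that by (auto simp: possible_leaves_def)
  assume "map (sat G v) \<delta>s \<in> possible_leaves m \<delta>s \<phi>"
  then obtain H :: "nat graph" and w where "map (sat G v) \<delta>s = map (sat H w) \<delta>s"
    and "graph m H" "w \<in> nodes H" "sat H w \<phi>"
    by (auto simp: possible_leaves_def)
  then show "sat G v \<phi>"
    using assms[OF G] by (metis map_eq_conv)
qed

section \<open>Subformulas and the layers built from them\<close>

primrec subforms :: "form \<Rightarrow> form list" where
  "subforms (Pred j) = [Pred j]"
| "subforms Top = [Top]"
| "subforms (Conj \<phi> \<psi>) = Conj \<phi> \<psi> # subforms \<phi> @ subforms \<psi>"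
| "subforms (Disj \<phi> \<psi>) = Disj \<phi> \<psi> # subforms \<phi> @ subforms \<psi>"
| "subforms (Neg \<phi>) = Neg \<phi> # subforms \<phi>"
| "subforms (More S \<phi> n) = More S \<phi> n # subforms \<phi>"

lemma subforms_refl: "\<phi> \<in> set (subforms \<phi>)"
  by (cases \<phi>) auto

text \<open>This makes the leaf set with index 0 the one that belongs to the whole formula.\<close>

lemma subforms_hd: "subforms \<phi> ! 0 = \<phi>"
  by (cases \<phi>) auto

lemma subforms_nonempty: "subforms \<phi> \<noteq> []"
  by (cases \<phi>) auto

lemma subforms_trans: "\<phi> \<in> set (subforms \<psi>) \<Longrightarrow> set (subforms \<phi>) \<subseteq> set (subforms \<psi>)"
  by (induction \<psi>) auto

lemma subforms_EMLC: "\<phi> \<in> set (subforms \<psi>) \<Longrightarrow> \<psi> \<in> EMLC m \<Longrightarrow> \<phi> \<in> EMLC m"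
  by (induction \<psi>) (auto simp: EMLC_def)

text \<open>Splitting decisions must be modal, so \<open>More P_I (Pred j) 0\<close> stands in for
  \<open>Pred j\<close>. The bound is \<open>Suc i\<close> because layers are counted from
  0.\<close>

definition layer_decisions :: "nat \<Rightarrow> form \<Rightarrow> nat \<Rightarrow> form list" where
  "layer_decisions m \<psi> i =
     map (\<lambda>j. More P_I (Pred j) 0) [0..<m] @
     filter (\<lambda>\<phi>. (\<exists>S \<theta> n. \<phi> = More S \<theta> n) \<and> depth \<phi> \<le> Suc i) (subforms \<psi>)"

lemma sat_More_P_I: "sat G v (More P_I \<phi> 0) \<longleftrightarrow> sat G v \<phi>"
proof -
  have "{w \<in> {v}. sat G w \<phi>} = (if sat G v \<phi> then {v} else {})"
    by auto
  then show ?thesis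
    by simp
qed

text \<open>The induction only passes through Boolean connectives: it stops at predicates and at
  modal subformulas, both represented among the decisions.\<close>

lemma layer_decisions_determine_sat:
  assumes "\<phi> \<in> EMLC m" and "set (subforms \<phi>) \<subseteq> set (subforms \<psi>)" and "depth \<phi> \<le> Suc i"
    and agree: "\<forall>\<delta>\<in>set (layer_decisions m \<psi> i). sat G v \<delta> = sat H w \<delta>"
  shows "sat G v \<phi> = sat H w \<phi>"
  using assms(1-3)
proof (induction \<phi>)
  case (Pred j)
  then have "More P_I (Pred j) 0 \<in> set (layer_decisions m \<psi> i)"
    by (auto simp: layer_decisions_def EMLC_def)
  with agree have "sat G v (More P_I (Pred j) 0) = sat H w (More P_I (Pred j) 0)"
    by (rule bspec)
  then show ?case
    unfolding sat_More_P_I .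
next
  case (More S \<phi> n)
  then have "More S \<phi> n \<in> set (layer_decisions m \<psi> i)"
    by (auto simp: layer_decisions_def)
  with agree show ?case
    by (rule bspec)
qed (auto simp: EMLC_def)

text \<open>Each layer has a leaf set for every subformula, but only those of depth at most
  \<open>Suc i\<close> are shown to be represented faithfully.\<close>

definition formula_layer :: "nat \<Rightarrow> form \<Rightarrow> nat \<Rightarrow> layer" where
  "formula_layer m \<psi> i =
     \<lparr>tree = complete_tree (layer_decisions m \<psi> i),
      leaf_sets = map (possible_leaves m (layer_decisions m \<psi> i)) (subforms \<psi>)\<rparr>"

lemma equivalent_chi_formula_layer:
  assumes "\<psi> \<in> EMLC m" and "\<phi> \<in> set (subforms \<psi>)" and "depth \<phi> \<le> Suc i"
  shows "equivalent m \<phi> (chi_set (tree (formula_layer m \<psi> i))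
    (possible_leaves m (layer_decisions m \<psi> i) \<phi>))"
  unfolding formula_layer_def layer.simps
proof (rule equivalent_chi_possible_leaves)
  fix G H :: "nat graph" and v w
  assume "\<forall>\<delta>\<in>set (layer_decisions m \<psi> i). sat G v \<delta> = sat H w \<delta>"
  with subforms_EMLC[OF assms(2,1)] subforms_trans[OF assms(2)] assms(3)
  show "sat G v \<phi> = sat H w \<phi>"
    by (rule layer_decisions_determine_sat)
qed

lemma idt_layer_formula_layer:
  assumes "\<psi> \<in> EMLC m"
  shows "idt_layer m (formula_layer m \<psi> i)"
proof -
  have "\<exists>S \<phi> n. \<delta> = More S \<phi> n \<and> \<phi> \<in> EMLC m" if "\<delta> \<in> set (layer_decisions m \<psi> i)" for \<delta>
    using that subforms_EMLC[OF _ assms] by (fastforce simp: layer_decisions_def EMLC_def)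
  then show ?thesis
    using possible_leaves_subset by (auto simp: idt_layer_def formula_layer_def decisions_complete_tree)
qed

lemma iterated_decision_tree_formula_layers:
  assumes "\<psi> \<in> EMLC m"
  shows "iterated_decision_tree m k (map (formula_layer m \<psi>) [0..<k])"
proof -
  have "\<exists>l<i. \<exists>M\<in>set (leaf_sets (formula_layer m \<psi> l)).
      equivalent m \<phi> (chi_set (tree (formula_layer m \<psi> l)) M)"
    if "More S \<phi> n \<in> decisions (tree (formula_layer m \<psi> i))" and "depth \<phi> \<noteq> 0" for i S \<phi> n
  proof -
    \<comment> \<open>Since \<open>depth \<phi> \<noteq> 0\<close>, the decision is not one of the
      stand-ins for predicates.\<close>
    have "More S \<phi> n \<in> set (subforms \<psi>)" "depth \<phi> \<le> i"
      using that by (auto simp: formula_layer_def decisions_complete_tree layer_decisions_def)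
    then have "\<phi> \<in> set (subforms \<psi>)"
      using subforms_trans subforms_refl by fastforce
    \<comment> \<open>This is the first layer whose depth bound admits \<open>\<phi>\<close>;
      positive depth makes it precede layer \<open>i\<close>.\<close>
    moreover define l where "l = depth \<phi> - 1"
    then have "l < i" "depth \<phi> \<le> Suc l"
      using \<open>depth \<phi> \<le> i\<close> \<open>depth \<phi> \<noteq> 0\<close> by auto
    moreover have "possible_leaves m (layer_decisions m \<psi> l) \<phi> \<in> set (leaf_sets (formula_layer m \<psi> l))"
      using \<open>\<phi> \<in> set (subforms \<psi>)\<close> by (simp add: formula_layer_def)
    ultimately show ?thesis
      using equivalent_chi_formula_layer[OF assms] by blast
  qed
  then show ?thesis
    using idt_layer_formula_layer[OF assms]
    by (fastforce simp: iterated_decision_tree_def)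
qed

subsection \<open>From iterated decision trees to formulas\<close>

lemma EMLC_foldr:
  assumes "set \<phi>s \<subseteq> EMLC m" and "\<phi> \<in> EMLC m"
  shows "foldr Conj \<phi>s \<phi> \<in> EMLC m" and "foldr Disj \<phi>s \<phi> \<in> EMLC m"
  using assms by (induction \<phi>s) (auto simp: EMLC_def)

lemma depth_foldr:
  assumes "\<forall>\<theta>\<in>set \<phi>s. depth \<theta> \<le> d" and "depth \<phi> \<le> d"
  shows "depth (foldr Conj \<phi>s \<phi>) \<le> d" and "depth (foldr Disj \<phi>s \<phi>) \<le> d"
  using assms by (induction \<phi>s) auto

lemma path_literals_subset: "set (path_literals T p) \<subseteq> decisions T \<union> Neg ` decisions T"
  by (induction T arbitrary: p) (fastforce split: if_splits)+

lemma chi_set_EMLC: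
  assumes "decisions T \<subseteq> EMLC m"
  shows "chi_set T M \<in> EMLC m"
proof -
  have "Neg \<delta> \<in> EMLC m" if "\<delta> \<in> EMLC m" for \<delta>
    using that by (simp add: EMLC_def)
  then have "set (path_literals T p) \<subseteq> EMLC m" for p
    using path_literals_subset[of T p] assms by blast
  then have "chi_leaf T p \<in> EMLC m" for p
    unfolding chi_leaf_def by (intro EMLC_foldr) (auto simp: EMLC_def)
  then show ?thesis
    unfolding chi_set_def by (intro EMLC_foldr) (auto simp: EMLC_def)
qed

lemma depth_chi_set:
  assumes "\<forall>\<delta>\<in>decisions T. depth \<delta> \<le> d"
  shows "depth (chi_set T M) \<le> d"
proof -
  have "\<forall>\<theta>\<in>set (path_literals T p). depth \<theta> \<le> d" for p
    using path_literals_subset[of T p] assms by auto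
  then have "depth (chi_leaf T p) \<le> d" for p
    unfolding chi_leaf_def by (intro depth_foldr) auto
  then show ?thesis
    unfolding chi_set_def by (intro depth_foldr) auto
qed

lemma leaves_map_dtree: "leaves (map_dtree f T) = leaves T"
  by (induction T) auto

text \<open>Relabelling the decisions keeps the shape of the tree, so the same paths and leaf sets
  still make sense.\<close>

lemma sat_chi_set_map_dtree:
  assumes "\<forall>\<delta>\<in>decisions T. sat G v (f \<delta>) = sat G v \<delta>"
  shows "sat G v (chi_set (map_dtree f T) M) = sat G v (chi_set T M)"
proof -
  have "sat G v (chi_leaf (map_dtree f T) p) = sat G v (chi_leaf T p)" for p
    using assms unfolding chi_leaf_def by (induction T arbitrary: p) auto
  then show ?thesis
    by (simp add: sat_chi_set leaves_map_dtree)
qed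

text \<open>The formula under the modal parameter may itself be arbitrarily deep; it is replaced by
  an equivalent one from an earlier layer \<open>l\<close>, where
  \<open>Suc l \<le> i\<close>.\<close>

lemma decision_equivalent_bounded_depth:
  assumes Ls: "iterated_decision_tree m k Ls" and "i < k" and "\<delta> \<in> decisions (tree (Ls ! i))"
    and IH: "\<And>l M. l < i \<Longrightarrow>
      \<exists>\<psi>\<in>EMLC m. depth \<psi> \<le> Suc l \<and> equivalent m \<psi> (chi_set (tree (Ls ! l)) M)"
  shows "\<exists>\<psi>\<in>EMLC m. depth \<psi> \<le> Suc i \<and> equivalent m \<psi> \<delta>"
proof -
  have "idt_layer m (Ls ! i)"
    using Ls \<open>i < k\<close> by (auto simp: iterated_decision_tree_def)
  then obtain S \<phi> n where \<delta>: "\<delta> = More S \<phi> n" "\<phi> \<in> EMLC m"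
    using assms(3) unfolding idt_layer_def by blast
  have "\<exists>\<theta>\<in>EMLC m. depth \<theta> \<le> i \<and> equivalent m \<theta> \<phi>"
  proof (cases "depth \<phi> = 0")
    case True
    then show ?thesis
      using \<delta>(2) by (intro bexI[of _ \<phi>]) (auto simp: equivalent_def)
  next
    case False
    then obtain l M where "l < i" "equivalent m \<phi> (chi_set (tree (Ls ! l)) M)"
      using Ls \<open>i < k\<close> assms(3) unfolding \<delta>(1) iterated_decision_tree_def by metis
    then show ?thesis
      using IH[of l M] by (meson Suc_leI equivalent_sym equivalent_trans le_trans)
  qed
  then obtain \<theta> where "\<theta> \<in> EMLC m" "depth \<theta> \<le> i" "equivalent m \<theta> \<phi>"
    by blast
  then show ?thesis
    using equivalent_More unfolding \<delta>(1)
    by (intro bexI[of _ "More S \<theta> n"]) (auto simp: EMLC_def)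
qed

lemma chi_equivalent_bounded_depth:
  assumes "iterated_decision_tree m k Ls" and "i < k"
  shows "\<exists>\<psi>\<in>EMLC m. depth \<psi> \<le> Suc i \<and> equivalent m \<psi> (chi_set (tree (Ls ! i)) M)"
  using assms(2)
proof (induction i arbitrary: M rule: less_induct)
  case (less i)
  let ?T = "tree (Ls ! i)"
  have "\<exists>\<psi>\<in>EMLC m. depth \<psi> \<le> Suc i \<and> equivalent m \<psi> \<delta>" if "\<delta> \<in> decisions ?T" for \<delta>
    using decision_equivalent_bounded_depth[OF assms(1) less.prems that] less.IH less.prems by simp
  \<comment> \<open>The function \<open>f\<close> chooses one shallow replacement for each decision,
    to be applied throughout the tree.\<close>
  then obtain f where f: "\<And>\<delta>. \<delta> \<in> decisions ?T \<Longrightarrow>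
      f \<delta> \<in> EMLC m \<and> depth (f \<delta>) \<le> Suc i \<and> equivalent m (f \<delta>) \<delta>"
    by metis
  show ?case
  proof (intro bexI conjI)
    show "chi_set (map_dtree f ?T) M \<in> EMLC m"
      using f by (intro chi_set_EMLC) (auto simp: dtree.set_map)
    show "depth (chi_set (map_dtree f ?T) M) \<le> Suc i"
      using f by (intro depth_chi_set) (auto simp: dtree.set_map)
    show "equivalent m (chi_set (map_dtree f ?T) M) (chi_set ?T M)"
      unfolding equivalent_def using f
      by (intro allI impI sat_chi_set_map_dtree) (auto simp: equivalent_def)
  qed
qed

text \<open>Prefixing \<open>P_0\<close> raises the depth by one and counts over the empty set, so
  no node satisfies the result.\<close>

lemma exists_contradiction_of_depth: "\<exists>\<phi>\<in>EMLC m. depth \<phi> = k \<and> (\<forall>G v. \<not> sat G v \<phi>)"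
proof (induction k)
  case 0
  show ?case
    by (intro bexI[of _ "Neg Top"]) (auto simp: EMLC_def)
next
  case (Suc k)
  then obtain \<phi> where "\<phi> \<in> EMLC m" "depth \<phi> = k"
    by blast
  then show ?case
    by (intro bexI[of _ "More P_0 \<phi> 0"]) (auto simp: EMLC_def)
qed

lemma exists_equivalent_of_depth:
  assumes "\<phi> \<in> EMLC m" and "depth \<phi> \<le> k"
  shows "\<exists>\<psi>\<in>EMLC m. depth \<psi> = k \<and> equivalent m \<psi> \<phi>"
proof -
  obtain \<theta> where "\<theta> \<in> EMLC m" "depth \<theta> = k" and "\<And>(G :: nat graph) v. \<not> sat G v \<theta>"
    using exists_contradiction_of_depth[where ?'a = nat] by blast
  then show ?thesis
    using assms by (intro bexI[of _ "Disj \<phi> \<theta>"]) (auto simp: EMLC_def equivalent_def)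
qed

theorem theorem3:
  fixes m k :: nat
  assumes "k > 0"
  shows "(\<forall>\<psi>\<in>EMLC m. depth \<psi> = k \<longrightarrow>
           (\<exists>Ls. iterated_decision_tree m k Ls \<and>
                 0 < length (leaf_sets (Ls ! (k - 1))) \<and>
                 equivalent m (chi Ls (k - 1) 0) \<psi>)) \<and>
         (\<forall>Ls j. iterated_decision_tree m k Ls \<longrightarrow> j < length (leaf_sets (Ls ! (k - 1))) \<longrightarrow>
           (\<exists>\<psi>\<in>EMLC m. depth \<psi> = k \<and> equivalent m \<psi> (chi Ls (k - 1) j)))"
proof (intro conjI ballI allI impI)
  fix \<psi> assume \<psi>: "\<psi> \<in> EMLC m" "depth \<psi> = k"
  let ?L = "formula_layer m \<psi> (k - 1)" and ?Ls = "map (formula_layer m \<psi>) [0..<k]"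
  \<comment> \<open>Here \<open>k > 0\<close> ensures that \<open>k - 1\<close> is a valid index,
    and thus that a last layer exists.\<close>
  have L: "?Ls ! (k - 1) = ?L"
    using assms by simp
  have "leaf_sets ?L ! 0 = possible_leaves m (layer_decisions m \<psi> (k - 1)) \<psi>"
    by (simp add: formula_layer_def subforms_nonempty subforms_hd)
  then have "equivalent m (chi ?Ls (k - 1) 0) \<psi>"
    using equivalent_chi_formula_layer[OF \<psi>(1) subforms_refl, of "k - 1"] \<psi>(2)
    unfolding chi_def L by (simp add: equivalent_sym)
  moreover have "0 < length (leaf_sets ?L)"
    by (simp add: formula_layer_def subforms_nonempty)
  ultimately show "\<exists>Ls. iterated_decision_tree m k Ls \<and>
      0 < length (leaf_sets (Ls ! (k - 1))) \<and> equivalent m (chi Ls (k - 1) 0) \<psi>"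
    using iterated_decision_tree_formula_layers[OF \<psi>(1)] L by metis
next
  fix Ls j assume "iterated_decision_tree m k Ls"
  then obtain \<phi> where "\<phi> \<in> EMLC m" "depth \<phi> \<le> k" "equivalent m \<phi> (chi Ls (k - 1) j)"
    using chi_equivalent_bounded_depth[of m k Ls "k - 1"] assms unfolding chi_def by auto
  then show "\<exists>\<psi>\<in>EMLC m. depth \<psi> = k \<and> equivalent m \<psi> (chi Ls (k - 1) j)"
    using exists_equivalent_of_depth equivalent_trans by blast
qed

end
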